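(* Let $(p_n)_{n\ge1}$ be a sequence of non-negative reals with $\sum_{n\ge1}p_n=1$ and $\gcd\{k\ge1:p_k>0\}=1$, let $z_n=\sum_{k>n}p_k$, and let $P$ be the transition operator of the associated Markov chain on $\{0,1,2,\ldots\}$. Suppose that $n\mapsto z_n$ is regularly varying with index $-\alpha$. (1) If $\alpha>1$, then there is a constant $\kappa>0$ such that for all integers $n\ge0$ and $\ell\ge1$ $$\|P^{n+\ell}\delta_0-P^n\delta_0\|_{\mathrm{TV}}\ge\kappa\sum_{m=n+1}^{n+\ell}z_m;$$ in particular there is $\kappa'>0$ with $\|P^{n+\ell}\delta_0-P^n\delta_0\|_{\mathrm{TV}}\ge\kappa'\,\ell z_n$ for all $1\le\ell\le n$. (2) If $\alpha\in(0,1)$, then there is a constant $\kappa>0$ such that for all integers $n\ge0$ and $\ell\ge1$ $$\|P^{n+\ell}\delta_0-P^n\delta_0\|_{\mathrm{TV}}\ge\kappa\,\min\Bigl\{1,\frac{z_n}{z_\ell}\Bigr\}.$$ (3) If $\alpha=1$, then there is a constant $\kappa>0$ such that for all integers $1\le\ell\le n$ $$\|P^{n+\ell}\delta_0-P^n\delta_0\|_{\mathrm{TV}}\ge\kappa\, z_n\sum_{k=1}^{\ell-1}m(k)^{-1},\qquad\text{where } m(n)=\sum_{k=0}^{n-1}z_k.$$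
   Context: Model chain: given $p_n\ge0$ with $\sum_{n\ge1}p_n=1$, put $z_n=\sum_{k>n}p_k$ for $n\ge0$ and $q_n=p_{n+1}/z_n$ if $z_n>0$ (with $q_n\in[0,1]$ arbitrary if $z_n=0$). The associated Markov chain $X$ on $\{0,1,2,\ldots\}$ has transition probabilities $\mathbb P(X_1=0\mid X_0=n)=q_n$ and $\mathbb P(X_1=n+1\mid X_0=n)=1-q_n$. Thus $p_n$ is the probability that the first return time to $0$, starting from $0$, equals $n$. Its transition operator $P$ acts on probability measures: if $X_n\sim\mu$ then $X_{n+1}\sim P\mu$. $\delta_0$ is the unit mass at state $0$. $\|\cdot\|_{\mathrm{TV}}$ is the total variation norm, normalized so that $\|\mu-\nu\|_{\mathrm{TV}}=2\sup_A|\mu(A)-\nu(A)|$ for probability measures $\mu,\nu$. A sequence $n\mapsto z_n\in(0,\infty)$, $n\ge0$, is regularly varying with index $\beta$ if $\lim_{x\to\infty}z_{\lfloor\lambda x\rfloor}/z_{\lfloor x\rfloor}=\lambda^\beta$ for every real $\lambda>0$. *)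

theory Defs
  imports "HOL-Probability.Probability"
begin

text \<open>
  Return-time distributions are functions \<open>p :: nat \<Rightarrow> real\<close> of which only the values \<open>p n\<close> with
  \<open>n \<ge> 1\<close> are meaningful; no definition below looks at \<open>p 0\<close>.
\<close>

definition tail :: "(nat \<Rightarrow> real) \<Rightarrow> nat \<Rightarrow> real" where
  "tail p n = (\<Sum>\<^sub>\<infinity>k\<in>{n<..}. p k)"

text \<open>
  \<open>q\<close> is constrained by \<open>p\<close> rather than computed from it, since \<open>q n\<close> may be
  any element of \<open>[0,1]\<close> where the tail vanishes.
\<close>

definition return_probs :: "(nat \<Rightarrow> real) \<Rightarrow> (nat \<Rightarrow> real) \<Rightarrow> bool" where
  "return_probs p q \<longleftrightarrow>
     (\<forall>n. 0 \<le> q n \<and> q n \<le> 1) \<and> (\<forall>n. tail p n > 0 \<longrightarrow> q n = p (n + 1) / tail p n)"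

text \<open>From \<open>n\<close> the chain jumps to \<open>0\<close> with probability \<open>q n\<close> and otherwise to \<open>n + 1\<close>.\<close>

definition chain_kernel :: "(nat \<Rightarrow> real) \<Rightarrow> nat \<Rightarrow> nat pmf" where
  "chain_kernel q n = map_pmf (\<lambda>b. if b then 0 else n + 1) (bernoulli_pmf (q n))"

lemma pmf_chain_kernel:
  assumes "0 \<le> q n" "q n \<le> 1"
  shows "pmf (chain_kernel q n) 0 = q n" "pmf (chain_kernel q n) (n + 1) = 1 - q n"
proof -
  have "(\<lambda>b. if b then 0 else n + 1) -` {0} = {True}"
    and "(\<lambda>b. if b then 0 else n + 1) -` {n + 1} = {False}"
    by (auto split: if_splits)
  then show "pmf (chain_kernel q n) 0 = q n" "pmf (chain_kernel q n) (n + 1) = 1 - q n"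
    using assms by (simp_all add: chain_kernel_def pmf_map measure_pmf_single)
qed

definition transition_op :: "(nat \<Rightarrow> real) \<Rightarrow> nat pmf \<Rightarrow> nat pmf" where
  "transition_op q \<mu> = bind_pmf \<mu> (chain_kernel q)"

text \<open>The total variation norm of \<open>\<mu> - \<nu>\<close>, normalized to take values in \<open>[0,2]\<close>.\<close>

definition tv_dist :: "'a pmf \<Rightarrow> 'a pmf \<Rightarrow> real" where
  "tv_dist \<mu> \<nu> = 2 * (SUP A. \<bar>measure_pmf.prob \<mu> A - measure_pmf.prob \<nu> A\<bar>)"

definition regularly_varying :: "(nat \<Rightarrow> real) \<Rightarrow> real \<Rightarrow> bool" where
  "regularly_varying z \<beta> \<longleftrightarrow>
     (\<forall>n. z n > 0) \<and>
     (\<forall>c::real. c > 0 \<longrightarrow>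
        ((\<lambda>x::real. z (nat \<lfloor>c * x\<rfloor>) / z (nat \<lfloor>x\<rfloor>)) \<longlongrightarrow> c powr \<beta>) at_top)"

definition truncated_mean :: "(nat \<Rightarrow> real) \<Rightarrow> nat \<Rightarrow> real" where
  "truncated_mean p n = (\<Sum>k<n. tail p k)"

end

theory Submission
  imports Defs
begin

text \<open>
  Write \<open>u\<close> for the renewal sequence \<open>u n = P(X\<^sub>n = 0)\<close> and \<open>z = tail p\<close>. The law at time \<open>n\<close>
  gives mass \<open>u (n - j) * z j\<close> to each \<open>j \<le> n\<close> and lives on \<open>{..n}\<close>, so the distance is at least
  twice \<open>\<Sum>i<l. u i * z (n + l - i)\<close>. The total mass identity \<open>\<Sum>j\<le>n. u (n - j) * z j = 1\<close> replaces
  the renewal theorem: summed over \<open>n < l\<close> it gives \<open>\<Sum>i<l. u i \<ge> l / m l\<close> for the truncated mean \<open>m\<close>,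
  and for summable \<open>z\<close> it shows that all windows of \<open>u\<close> of some fixed length have mass at
  least \<open>1/2\<close>. Regular variation enters only through the ratios \<open>z (2 * n) / z n\<close>,
  and sums of slowly decreasing sequences are estimated along dyadic scales.
\<close>

section \<open>Monotone sequences along dyadic scales\<close>

lemma sum_lessThan_double:
  fixes f :: "nat \<Rightarrow> 'a :: comm_monoid_add"
  shows "(\<Sum>k<2 * n. f k) = (\<Sum>k<n. f k) + (\<Sum>k=n..<2 * n. f k)"
proof -
  have "{..<2 * n} = {..<n} \<union> {n..<2 * n}" by auto
  then show ?thesis by (simp add: sum.union_disjoint ivl_disj_int)
qed

text \<open>A one-sided Karamata estimate: eventually \<open>n * f n\<close> grows by at least the
  factor \<open>2 * r > 1\<close> at each doubling, so a partial sum is comparable to its last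
  dyadic block.\<close>

lemma sum_le_mult_nth:
  fixes f :: "nat \<Rightarrow> real"
  assumes anti: "antimono f" and pos: "\<And>n. f n > 0"
    and r: "1 / 2 < r" and ev: "eventually (\<lambda>n. r * f n \<le> f (2 * n)) sequentially"
  obtains C where "C > 0" "\<And>n. n \<ge> 1 \<Longrightarrow> (\<Sum>k<n. f k) \<le> C * real n * f n"
proof -
  obtain N0 where N0: "\<And>n. n \<ge> N0 \<Longrightarrow> r * f n \<le> f (2 * n)"
    using ev by (auto simp: eventually_sequentially)
  define N where "N = max N0 1"
  \<comment> \<open>The first entry gives \<open>C + 1 \<le> 2 * r * C\<close>, which lets the
    induction absorb the block added by a doubling; the second covers all
    \<open>n \<le> N\<close>.\<close>
  define C where "C = max (1 / (2 * r - 1)) (f 0 / f N)"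
  have C1: "C + 1 \<le> 2 * r * C" and C2: "f 0 \<le> C * f N" and C0: "C > 0"
  proof -
    have "1 / (2 * r - 1) \<le> C" by (simp add: C_def)
    then show "C + 1 \<le> 2 * r * C" using r by (simp add: field_simps)
    have "f 0 / f N \<le> C" by (simp add: C_def)
    then show "f 0 \<le> C * f N" using pos[of N] by (simp add: field_simps)
    show "C > 0" using r by (auto simp: C_def less_max_iff_disj)
  qed
  have small: "(\<Sum>k<n. f k) \<le> C * real n * f n" if "n \<le> N" for n
  proof -
    have "f 0 \<le> C * f n"
      using C2 C0 antimonoD[OF anti that] by (meson mult_left_mono order_trans less_imp_le)
    have "(\<Sum>k<n. f k) \<le> (\<Sum>k<n. f 0)"
      by (intro sum_mono antimonoD[OF anti]) auto
    moreover have "real n * f 0 \<le> real n * (C * f n)"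
      using \<open>f 0 \<le> C * f n\<close> by (rule mult_left_mono) simp
    ultimately show ?thesis by (simp add: mult_ac)
  qed
  have dyadic: "(\<Sum>k<2 ^ j * N. f k) \<le> C * real (2 ^ j * N) * f (2 ^ j * N)" for j
  proof (induction j)
    case 0
    then show ?case using small[of N] by simp
  next
    case (Suc j)
    define n where "n = 2 ^ j * N"
    have "N \<le> n" by (simp add: n_def)
    then have *: "r * f n \<le> f (2 * n)" by (intro N0) (simp add: N_def)
    have "(\<Sum>k=n..<2 * n. f k) \<le> (\<Sum>k=n..<2 * n. f n)"
      by (intro sum_mono antimonoD[OF anti]) auto
    then have "(\<Sum>k<2 * n. f k) \<le> C * real n * f n + real n * f n"
      using Suc.IH by (simp add: sum_lessThan_double flip: n_def)
    also have "\<dots> = (C + 1) * (real n * f n)" by (simp add: algebra_simps)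
    also have "\<dots> \<le> (2 * r * C) * (real n * f n)"
      by (intro mult_right_mono C1 mult_nonneg_nonneg) (simp_all add: less_imp_le[OF pos])
    also have "\<dots> = C * real (2 * n) * (r * f n)" by simp
    also have "\<dots> \<le> C * real (2 * n) * f (2 * n)"
      using * C0 by (intro mult_left_mono) auto
    finally show ?case by (simp add: n_def mult.assoc)
  qed
  have "(\<Sum>k<n. f k) \<le> 2 * C * real n * f n" for n
  proof -
    have "n \<le> 2 ^ n * N"
      by (metis N_def One_nat_def less_exp less_imp_le max.cobounded2 mult.right_neutral mult_le_mono)
    \<comment> \<open>The least dyadic scale above \<open>n\<close> overshoots by at most a factor 2
      unless \<open>j = 0\<close>, so doubling the constant extends the bound to every
      \<open>n\<close>.\<close>
    define j where "j = (LEAST j. n \<le> 2 ^ j * N)"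
    have j: "n \<le> 2 ^ j * N"
      unfolding j_def by (rule LeastI) fact
    show ?thesis
    proof (cases j)
      case 0
      then have "(\<Sum>k<n. f k) \<le> C * real n * f n" using small[of n] j by simp
      also have "\<dots> \<le> 2 * (C * real n * f n)" using C0 pos[of n] by simp
      finally show ?thesis by (simp add: mult_ac)
    next
      case (Suc i)
      then have "\<not> n \<le> 2 ^ i * N"
        using not_less_Least[of i "\<lambda>j. n \<le> 2 ^ j * N"] by (simp add: j_def)
      then have le: "2 ^ j * N \<le> 2 * n" using Suc by simp
      have "(\<Sum>k<n. f k) \<le> (\<Sum>k<2 ^ j * N. f k)"
        using j pos by (intro sum_mono2) (auto intro: less_imp_le)
      also have "\<dots> \<le> C * real (2 ^ j * N) * f (2 ^ j * N)" by (rule dyadic)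
      also have "\<dots> \<le> C * real (2 * n) * f n"
        using C0 pos le j
        by (intro mult_mono mult_left_mono antimonoD[OF anti] mult_nonneg_nonneg)
          (auto intro: less_imp_le simp only: of_nat_le_iff of_nat_0_le_iff)
      finally show ?thesis by (simp add: mult_ac)
    qed
  qed
  then show thesis using that[of "2 * C"] C0 by simp
qed

text \<open>Cauchy condensation: the condensed terms \<open>2 ^ j * f (2 ^ j)\<close> eventually
  shrink by the factor \<open>2 * r < 1\<close>.\<close>

lemma summable_dyadic_ratio:
  fixes f :: "nat \<Rightarrow> real"
  assumes anti: "antimono f" and nonneg: "\<And>n. f n \<ge> 0"
    and r: "r < 1 / 2" and ev: "eventually (\<lambda>n. f (2 * n) \<le> r * f n) sequentially"
  shows "summable f"
proof -
  obtain N where N: "\<And>n. n \<ge> N \<Longrightarrow> f (2 * n) \<le> r * f n"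
    using ev by (auto simp: eventually_sequentially)
  have "summable (\<lambda>j. 2 ^ j * f (2 ^ j))"
  proof (rule summable_ratio_test[of "2 * r" N])
    fix j assume "N \<le> j"
    then have "N \<le> 2 ^ j" using less_exp[of j] by linarith
    from N[OF this] show "norm (2 ^ Suc j * f (2 ^ Suc j)) \<le> 2 * r * norm (2 ^ j * f (2 ^ j))"
      using nonneg by (simp add: abs_mult)
  qed (use r in simp)
  then show ?thesis
    using condensation_test[of f] nonneg antimonoD[OF anti] by (simp add: le_Suc_eq)
qed

lemma regularly_varying_double:
  assumes "regularly_varying z \<beta>"
  shows "(\<lambda>n. z (2 * n) / z n) \<longlonglongrightarrow> 2 powr \<beta>"
proof -
  have "((\<lambda>x::real. z (nat \<lfloor>2 * x\<rfloor>) / z (nat \<lfloor>x\<rfloor>)) \<longlongrightarrow> 2 powr \<beta>) at_top"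
    using assms by (simp add: regularly_varying_def)
  from filterlim_compose[OF this filterlim_real_sequentially]
  have "(\<lambda>n. z (nat \<lfloor>2 * real n\<rfloor>) / z (nat \<lfloor>real n\<rfloor>)) \<longlonglongrightarrow> 2 powr \<beta>" .
  moreover have "nat \<lfloor>2 * real n\<rfloor> = 2 * n" for n
    by (metis floor_of_nat nat_int of_nat_mult of_nat_numeral)
  ultimately show ?thesis by simp
qed

section \<open>Total variation and the law of the chain at a fixed time\<close>

lemma tv_dist_ge: "tv_dist \<mu> \<nu> \<ge> 2 * (measure_pmf.prob \<mu> A - measure_pmf.prob \<nu> A)"
proof -
  let ?g = "\<lambda>A. \<bar>measure_pmf.prob \<mu> A - measure_pmf.prob \<nu> A\<bar>"
  have "?g A \<le> 1" for A
    using measure_pmf.prob_le_1[of \<mu> A] measure_pmf.prob_le_1[of \<nu> A]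
      measure_nonneg[of "measure_pmf \<mu>" A] measure_nonneg[of "measure_pmf \<nu>" A] by linarith
  then have "?g A \<le> (SUP A. ?g A)"
    by (intro cSUP_upper bdd_aboveI2[where M = 1]) auto
  then show ?thesis by (simp add: tv_dist_def)
qed

text \<open>Regular variation includes \<open>tail_pos\<close>, which fixes every \<open>q n\<close>
  as \<open>p (n + 1) / tail p n\<close>.\<close>

locale return_chain =
  fixes p q :: "nat \<Rightarrow> real"
  assumes p_nonneg: "\<And>n. n \<ge> 1 \<Longrightarrow> p n \<ge> 0"
    and p_sum: "(p has_sum 1) {1..}"
    and q: "return_probs p q"
    and tail_pos: "\<And>n. tail p n > 0"
begin

abbreviation law :: "nat \<Rightarrow> nat pmf" where
  "law n \<equiv> (transition_op q ^^ n) (return_pmf 0)"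

text \<open>Read off from the chain instead of a convolution recursion with \<open>p\<close>, so
  that the bounds 0 and 1 are immediate.\<close>

definition renewal :: "nat \<Rightarrow> real" where
  "renewal n = pmf (law n) 0"

lemma renewal_0: "renewal 0 = 1"
  by (simp add: renewal_def)

lemma renewal_nonneg: "renewal n \<ge> 0"
  by (simp add: renewal_def)

lemma p_summable_on: "p summable_on {n<..}"
  by (rule summable_on_subset_banach[of _ "{1..}"]) (use p_sum in \<open>auto simp: summable_on_def\<close>)

lemma tail_0: "tail p 0 = 1"
proof -
  have "{0<..} = {1::nat..}" by auto
  then show ?thesis using p_sum by (simp add: tail_def infsumI)
qed

lemma tail_Suc: "tail p n = p (Suc n) + tail p (Suc n)"
proof -
  have "{n<..} = {Suc n} \<union> {Suc n<..}" by auto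
  then show ?thesis
    unfolding tail_def using infsum_Un_disjoint[of p "{Suc n}" "{Suc n<..}"] p_summable_on[of "Suc n"]
    by simp
qed

lemma antimono_tail: "antimono (tail p)"
  unfolding decseq_Suc_iff
proof
  show "tail p (Suc n) \<le> tail p n" for n
    using p_nonneg[of "Suc n"] tail_Suc[of n] by simp
qed

lemma q_bounds: "0 \<le> q n" "q n \<le> 1"
  using q by (auto simp: return_probs_def)

text \<open>\<open>tail p n\<close> is the probability that an excursion from 0 lasts longer than
  \<open>n\<close> steps, and \<open>1 - q n\<close> is the chance of surviving one step
  more.\<close>

lemma tail_mult_survival: "tail p n * (1 - q n) = tail p (Suc n)"
proof -
  have "q n = p (Suc n) / tail p n"
    using q tail_pos[of n] by (simp add: return_probs_def)
  then show ?thesis using tail_Suc[of n] tail_pos[of n] by (simp add: field_simps)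
qed

lemma pmf_chain_kernel_Suc: "pmf (chain_kernel q n) (Suc k) = (if k = n then 1 - q n else 0)"
proof (cases "k = n")
  case False
  then have "Suc k \<notin> set_pmf (chain_kernel q n)"
    by (auto simp: chain_kernel_def split: if_splits)
  then show ?thesis using False by (simp add: set_pmf_iff)
qed (use pmf_chain_kernel(2)[of q n] q_bounds in simp)

text \<open>The state \<open>Suc k\<close> can be entered only from \<open>k\<close>.\<close>

lemma pmf_law_Suc: "pmf (law (Suc n)) (Suc k) = pmf (law n) k * (1 - q k)"
proof -
  have "pmf (law (Suc n)) (Suc k) = (\<integral>m. (if k = m then 1 - q m else 0) \<partial>measure_pmf (law n))"
    by (simp add: transition_op_def pmf_bind pmf_chain_kernel_Suc)
  also have "\<dots> = (\<Sum>m\<in>{k}. (if k = m then 1 - q m else 0) * pmf (law n) m)"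
    by (rule integral_measure_pmf_real) (auto split: if_splits)
  finally show ?thesis by simp
qed

text \<open>Decomposition by the time \<open>n - j\<close> of the last visit to \<open>0\<close>.\<close>

lemma pmf_law: "pmf (law n) j = (if j \<le> n then renewal (n - j) * tail p j else 0)"
proof (induction n arbitrary: j)
  case 0
  then show ?case by (simp add: renewal_0 tail_0 pmf_return)
next
  case (Suc n)
  show ?case
  proof (cases j)
    case 0
    then show ?thesis by (simp add: renewal_def tail_0)
  next
    case (Suc k)
    then show ?thesis
      using Suc.IH[of k] tail_mult_survival[of k] by (simp add: pmf_law_Suc mult.assoc del: funpow.simps)
  qed
qed

lemma set_pmf_law: "set_pmf (law n) \<subseteq> {..n}"
  by (auto simp: set_pmf_iff pmf_law split: if_splits)

lemma renewal_equation: "(\<Sum>j\<le>n. renewal (n - j) * tail p j) = 1"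
  using sum_pmf_eq_1[OF _ set_pmf_law[of n]] by (simp add: pmf_law)

lemma renewal_le_1: "renewal n \<le> 1"
  by (simp add: renewal_def pmf_le_1)

text \<open>The test set \<open>{n<..n + l}\<close> is out of reach at time \<open>n\<close>. At
  time \<open>n + l\<close> its states are indexed by the time \<open>i = n + l - j\<close> of the
  last visit to 0.\<close>

lemma tv_dist_law_ge:
  "tv_dist (law (n + l)) (law n) \<ge> 2 * (\<Sum>i<l. renewal i * tail p (n + l - i))"
proof -
  have "measure_pmf.prob (law n) {n<..n + l} = 0"
    by (simp add: measure_measure_pmf_finite pmf_law)
  moreover have "measure_pmf.prob (law (n + l)) {n<..n + l} = (\<Sum>j\<in>{n<..n + l}. renewal (n + l - j) * tail p j)"
    by (simp add: measure_measure_pmf_finite pmf_law)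
  moreover have "\<dots> = (\<Sum>i<l. renewal i * tail p (n + l - i))"
    by (rule sum.reindex_bij_witness[of _ "\<lambda>i. n + l - i" "\<lambda>j. n + l - j"]) auto
  ultimately show ?thesis using tv_dist_ge[of "law (n + l)" "{n<..n + l}" "law n"] by simp
qed

section \<open>Lower bounds on renewal mass\<close>

lemma truncated_mean_pos: "n \<ge> 1 \<Longrightarrow> truncated_mean p n > 0"
  unfolding truncated_mean_def by (intro sum_pos tail_pos) (auto simp: lessThan_empty_iff)

lemma mono_truncated_mean: "mono (truncated_mean p)"
  unfolding truncated_mean_def
  by (intro monoI sum_mono2) (auto intro: less_imp_le[OF tail_pos])

text \<open>Summing the renewal equation over the times below \<open>l\<close>.\<close>

lemma sum_renewal_ge: "real l \<le> (\<Sum>i<l. renewal i) * truncated_mean p l"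
proof -
  have "real l = (\<Sum>n<l. \<Sum>j\<le>n. renewal (n - j) * tail p j)"
    by (simp add: renewal_equation)
  also have "\<dots> = (\<Sum>(n, j)\<in>(SIGMA n:{..<l}. {..n}). renewal (n - j) * tail p j)"
    by (simp add: sum.Sigma)
  \<comment> \<open>Regrouping by the visit time \<open>i = n - j\<close> gives a triangle, which is
    then enlarged to a square so that the sum factorizes.\<close>
  also have "\<dots> = (\<Sum>(i, j)\<in>{(i, j). i + j < l}. renewal i * tail p j)"
    by (rule sum.reindex_bij_witness[of _ "\<lambda>(i, j). (i + j, j)" "\<lambda>(n, j). (n - j, j)"]) auto
  also have "\<dots> \<le> (\<Sum>(i, j)\<in>{..<l} \<times> {..<l}. renewal i * tail p j)"
    by (rule sum_mono2) (auto intro!: mult_nonneg_nonneg renewal_nonneg less_imp_le[OF tail_pos])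
  also have "\<dots> = (\<Sum>i<l. renewal i) * truncated_mean p l"
    by (simp add: truncated_mean_def sum_product sum.cartesian_product)
  finally show ?thesis .
qed

text \<open>Every tail in \<open>tv_dist_law_ge\<close> is at least \<open>tail p (n + l)\<close>,
  and the remaining renewal mass is bounded by \<open>sum_renewal_ge\<close>. The cases \<alpha> < 1
  and \<alpha> = 1 rest on this bound.\<close>

lemma tv_dist_law_ge_truncated_mean:
  assumes "l \<ge> 1"
  shows "tv_dist (law (n + l)) (law n) \<ge> tail p (n + l) * (real l / truncated_mean p l)"
proof -
  let ?S = "\<Sum>i<l. renewal i * tail p (n + l - i)"
  have "real l / truncated_mean p l \<le> (\<Sum>i<l. renewal i)"
    using sum_renewal_ge[of l] truncated_mean_pos[OF assms] by (simp add: divide_le_eq)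
  then have "tail p (n + l) * (real l / truncated_mean p l) \<le> tail p (n + l) * (\<Sum>i<l. renewal i)"
    by (intro mult_left_mono less_imp_le[OF tail_pos])
  also have "\<dots> \<le> ?S"
    unfolding sum_distrib_left
    by (subst mult.commute, intro sum_mono mult_left_mono renewal_nonneg antimonoD[OF antimono_tail]) auto
  also have "0 \<le> ?S"
    by (intro sum_nonneg mult_nonneg_nonneg renewal_nonneg less_imp_le[OF tail_pos])
  then have "?S \<le> 2 * ?S" by simp
  also have "\<dots> \<le> tv_dist (law (n + l)) (law n)" by (rule tv_dist_law_ge)
  finally show ?thesis .
qed

text \<open>Choose \<open>N\<close> so that the tails from \<open>N\<close> on sum to less than 1/2.
  As \<open>renewal\<close> is at most 1, the terms \<open>j < N\<close> of the renewal equation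
  carry at least 1/2, and their weights \<open>tail p j\<close> are at most 1.\<close>

lemma renewal_window:
  assumes "summable (tail p)"
  obtains N where "\<And>n. (\<Sum>j | j < N \<and> j \<le> n. renewal (n - j)) \<ge> 1 / 2"
proof -
  obtain N where N: "norm (\<Sum>j. tail p (j + N)) < 1 / 2"
    using suminf_exist_split[of "1 / 2" "tail p"] assms by (auto simp: add.commute)
  have far: "(\<Sum>j\<in>{N..n}. renewal (n - j) * tail p j) \<le> 1 / 2" for n
  proof -
    have "(\<Sum>j\<in>{N..n}. renewal (n - j) * tail p j) \<le> (\<Sum>j\<in>{N..n}. tail p j)"
      using tail_pos renewal_nonneg renewal_le_1
      by (intro sum_mono mult_left_le_one_le) (auto intro: less_imp_le)
    also have "\<dots> = (\<Sum>j<Suc n - N. tail p (j + N))"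
      by (rule sum.reindex_bij_witness[of _ "\<lambda>j. j + N" "\<lambda>j. j - N"]) auto
    also have "\<dots> \<le> (\<Sum>j. tail p (j + N))"
      using assms by (intro sum_le_suminf) (auto intro: less_imp_le[OF tail_pos])
    finally show ?thesis using N by simp
  qed
  have "(\<Sum>j | j < N \<and> j \<le> n. renewal (n - j)) \<ge> 1 / 2" for n
  proof -
    have "{..n} = {j. j < N \<and> j \<le> n} \<union> {N..n}" by auto
    then have "1 = (\<Sum>j | j < N \<and> j \<le> n. renewal (n - j) * tail p j) + (\<Sum>j\<in>{N..n}. renewal (n - j) * tail p j)"
      using renewal_equation[of n] by (simp add: sum.union_disjoint disjoint_iff)
    also have "(\<Sum>j | j < N \<and> j \<le> n. renewal (n - j) * tail p j) \<le> (\<Sum>j | j < N \<and> j \<le> n. renewal (n - j))"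
      using renewal_nonneg antimonoD[OF antimono_tail, of 0] tail_0
      by (intro sum_mono mult_right_le_one_le) (auto intro: less_imp_le[OF tail_pos])
    finally show ?thesis using far[of n] by linarith
  qed
  then show thesis using that by blast
qed

end

section \<open>Comparison of tails under regular variation\<close>

locale regular_return_chain = return_chain +
  fixes \<alpha> :: real
  assumes reg: "regularly_varying (tail p) (- \<alpha>)"
begin

lemma tail_double_lim: "(\<lambda>n. tail p (2 * n) / tail p n) \<longlonglongrightarrow> 2 powr (- \<alpha>)"
  by (rule regularly_varying_double[OF reg])

lemma tail_double_ge:
  obtains c where "c > 0" "\<And>n. c * tail p n \<le> tail p (2 * n)"
proof -
  obtain N where N: "\<And>n. n \<ge> N \<Longrightarrow> tail p (2 * n) / tail p n > 2 powr (- \<alpha>) / 2"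
    using order_tendstoD(1)[OF tail_double_lim, of "2 powr (- \<alpha>) / 2"]
    by (auto simp: eventually_sequentially)
  \<comment> \<open>The first entry serves \<open>n \<ge> N\<close>. The second serves
    \<open>n < N\<close>, where \<open>tail p n \<le> 1\<close> and
    \<open>tail p (2 * n) \<ge> tail p (2 * N)\<close>.\<close>
  define c where "c = min (2 powr (- \<alpha>) / 2) (tail p (2 * N))"
  have "c * tail p n \<le> tail p (2 * n)" for n
  proof (cases "N \<le> n")
    case True
    then have "2 powr (- \<alpha>) / 2 * tail p n \<le> tail p (2 * n)"
      using N[of n] tail_pos[of n] by (simp add: field_simps)
    moreover have "c * tail p n \<le> 2 powr (- \<alpha>) / 2 * tail p n"
      using tail_pos[of n] by (intro mult_right_mono) (auto simp: c_def)
    ultimately show ?thesis by linarith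
  next
    case False
    have "c * tail p n \<le> tail p (2 * N) * 1"
      using tail_pos tail_0 antimonoD[OF antimono_tail, of 0 n]
      by (intro mult_mono) (auto simp: c_def intro: less_imp_le)
    also have "\<dots> \<le> tail p (2 * n)"
      using False antimonoD[OF antimono_tail, of "2 * n" "2 * N"] by simp
    finally show ?thesis .
  qed
  moreover have "c > 0" using tail_pos by (simp add: c_def)
  ultimately show thesis using that by blast
qed

text \<open>A shift by at most \<open>N\<close> stays within \<open>N\<close> doublings, since
  \<open>n + j \<le> Suc N * n \<le> 2 ^ N * n\<close>; the first inequality uses
  \<open>n \<ge> 1\<close>.\<close>

lemma tail_shift_ge:
  obtains c where "c > 0" "\<And>n j. n \<ge> 1 \<Longrightarrow> j \<le> N \<Longrightarrow> c * tail p n \<le> tail p (n + j)"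
proof -
  obtain c where c: "c > 0" "\<And>n. c * tail p n \<le> tail p (2 * n)" using tail_double_ge by metis
  have pow: "c ^ k * tail p n \<le> tail p (2 ^ k * n)" for k n
  proof (induction k)
    case (Suc k)
    have "c ^ Suc k * tail p n \<le> c * tail p (2 ^ k * n)"
      using mult_left_mono[OF Suc.IH, of c] c(1) by (simp add: mult_ac)
    also have "\<dots> \<le> tail p (2 ^ Suc k * n)"
      using c(2)[of "2 ^ k * n"] by (simp add: mult_ac)
    finally show ?case .
  qed simp
  have "c ^ N * tail p n \<le> tail p (n + j)" if "n \<ge> 1" "j \<le> N" for n j
  proof -
    have "n + j \<le> Suc N * n"
      using that by (cases n) (auto simp: algebra_simps)
    also have "\<dots> \<le> 2 ^ N * n"
      using less_exp[of N] by (intro mult_right_mono) (auto simp only: Suc_le_eq)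
    finally show ?thesis
      using pow[of N n] antimonoD[OF antimono_tail, of "n + j" "2 ^ N * n"] by linarith
  qed
  then show thesis using that[of "c ^ N"] c(1) by simp
qed

section \<open>The case \<alpha> > 1\<close>

text \<open>For each \<open>i < l\<close>, the window of at most \<open>N\<close> times ending at
  \<open>i\<close> has renewal mass at least 1/2, and \<open>tail_shift_ge\<close> moves
  \<open>tail p (n + l - i)\<close> to the times in that window at bounded cost. Summing over
  \<open>i\<close> counts each time at most \<open>N\<close> times.\<close>

lemma tv_dist_law_ge_tails:
  assumes "\<alpha> > 1"
  shows "\<exists>\<kappa>>0. \<forall>n l. l \<ge> 1 \<longrightarrow>
    tv_dist (law (n + l)) (law n) \<ge> \<kappa> * (\<Sum>m = n + 1..n + l. tail p m)"
proof -
  have "2 powr (- \<alpha>) < 2 powr (- 1)" using assms by (intro powr_less_mono) auto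
  then have "2 powr (- \<alpha>) < 1 / 2" by (simp add: powr_minus)
  then obtain r where r: "2 powr (- \<alpha>) < r" "r < 1 / 2" using dense by blast
  have "eventually (\<lambda>n. tail p (2 * n) \<le> r * tail p n) sequentially"
    using order_tendstoD(2)[OF tail_double_lim r(1)]
    by eventually_elim (use tail_pos in \<open>simp add: field_simps\<close>)
  then have "summable (tail p)"
    using r(2) antimono_tail tail_pos by (intro summable_dyadic_ratio) (auto intro: less_imp_le)
  then obtain N where N: "\<And>n. (\<Sum>j | j < N \<and> j \<le> n. renewal (n - j)) \<ge> 1 / 2"
    using renewal_window by metis
  obtain c where c: "c > 0" "\<And>n j. n \<ge> 1 \<Longrightarrow> j \<le> N \<Longrightarrow> c * tail p n \<le> tail p (n + j)"
    using tail_shift_ge[of N] by metis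
  have "N > 0" using N[of 0] by (cases N) auto
  have "tv_dist (law (n + l)) (law n) \<ge> (c / N) * (\<Sum>m = n + 1..n + l. tail p m)" for n l
  proof -
    let ?S = "\<Sum>i<l. renewal i * tail p (n + l - i)"
    have *: "c * tail p (n + l - i) * (1 / 2) \<le> (\<Sum>j | j < N \<and> j \<le> i. renewal (i - j) * tail p (n + l - (i - j)))"
      if "i < l" for i
    proof -
      have "c * tail p (n + l - i) * (1 / 2) \<le> c * tail p (n + l - i) * (\<Sum>j | j < N \<and> j \<le> i. renewal (i - j))"
        using c(1) tail_pos by (intro mult_left_mono N) (auto intro: less_imp_le)
      also have "\<dots> = (\<Sum>j | j < N \<and> j \<le> i. renewal (i - j) * (c * tail p (n + l - i)))"
        by (simp add: sum_distrib_left mult_ac)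
      also have "\<dots> \<le> (\<Sum>j | j < N \<and> j \<le> i. renewal (i - j) * tail p (n + l - (i - j)))"
      proof (intro sum_mono mult_left_mono renewal_nonneg)
        fix j assume "j \<in> {j. j < N \<and> j \<le> i}"
        then show "c * tail p (n + l - i) \<le> tail p (n + l - (i - j))"
          using c(2)[of "n + l - i" j] that by simp
      qed
      finally show ?thesis .
    qed
    have "(\<Sum>m = n + 1..n + l. tail p m) = (\<Sum>i<l. tail p (n + l - i))"
      by (rule sum.reindex_bij_witness[of _ "\<lambda>i. n + l - i" "\<lambda>j. n + l - j"]) auto
    then have "c * (\<Sum>m = n + 1..n + l. tail p m) = 2 * (\<Sum>i<l. c * tail p (n + l - i) * (1 / 2))"
      by (simp add: sum_distrib_left)
    also have "(\<Sum>i<l. c * tail p (n + l - i) * (1 / 2))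
        \<le> (\<Sum>i<l. \<Sum>j | j < N \<and> j \<le> i. renewal (i - j) * tail p (n + l - (i - j)))"
      using * by (intro sum_mono) auto
    also have "\<dots> = (\<Sum>(i, j)\<in>(SIGMA i:{..<l}. {j. j < N \<and> j \<le> i}). renewal (i - j) * tail p (n + l - (i - j)))"
      by (subst sum.Sigma) auto
    \<comment> \<open>Regroup by the visit time \<open>k = i - j\<close>; each \<open>k\<close> then
      meets at most \<open>N\<close> values of \<open>j\<close>.\<close>
    also have "\<dots> = (\<Sum>(k, j)\<in>{(k, j). k + j < l \<and> j < N}. renewal k * tail p (n + l - k))"
      by (rule sum.reindex_bij_witness[of _ "\<lambda>(k, j). (k + j, j)" "\<lambda>(i, j). (i - j, j)"]) auto
    also have "\<dots> \<le> (\<Sum>(k, j)\<in>{..<l} \<times> {..<N}. renewal k * tail p (n + l - k))"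
      by (rule sum_mono2) (auto intro!: mult_nonneg_nonneg renewal_nonneg less_imp_le[OF tail_pos])
    also have "\<dots> = real N * ?S"
      by (simp add: sum.cartesian_product[symmetric] sum_distrib_left)
    finally have "c * (\<Sum>m = n + 1..n + l. tail p m) \<le> real N * (2 * ?S)" by simp
    also have "\<dots> \<le> real N * tv_dist (law (n + l)) (law n)"
      by (intro mult_left_mono tv_dist_law_ge) auto
    finally show ?thesis using \<open>N > 0\<close> by (simp add: field_simps)
  qed
  then show ?thesis using c(1) \<open>N > 0\<close> by (intro exI[of _ "c / N"]) auto
qed

text \<open>For \<open>l \<le> n\<close> each of the \<open>l\<close> tails has index at most
  \<open>2 * n\<close>, so one doubling compares it with \<open>tail p n\<close>.\<close>

lemma tv_dist_law_ge_linear: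
  assumes "\<alpha> > 1"
  shows "\<exists>\<kappa>>0. \<forall>n l. 1 \<le> l \<and> l \<le> n \<longrightarrow>
    tv_dist (law (n + l)) (law n) \<ge> \<kappa> * real l * tail p n"
proof -
  obtain \<kappa> where \<kappa>: "\<kappa> > 0"
    "\<And>n l. l \<ge> 1 \<Longrightarrow> tv_dist (law (n + l)) (law n) \<ge> \<kappa> * (\<Sum>m = n + 1..n + l. tail p m)"
    using tv_dist_law_ge_tails[OF assms] by metis
  obtain c where c: "c > 0" "\<And>n. c * tail p n \<le> tail p (2 * n)" using tail_double_ge by metis
  have "tv_dist (law (n + l)) (law n) \<ge> (\<kappa> * c) * real l * tail p n" if "1 \<le> l" "l \<le> n" for n l
  proof -
    have "real l * (c * tail p n) = (\<Sum>m = n + 1..n + l. c * tail p n)" by simp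
    also have "\<dots> \<le> (\<Sum>m = n + 1..n + l. tail p m)"
    proof (rule sum_mono)
      fix m assume "m \<in> {n + 1..n + l}"
      then show "c * tail p n \<le> tail p m"
        using that c(2)[of n] antimonoD[OF antimono_tail, of m "2 * n"] by simp
    qed
    finally have "\<kappa> * (real l * (c * tail p n)) \<le> \<kappa> * (\<Sum>m = n + 1..n + l. tail p m)"
      using \<kappa>(1) by simp
    then show ?thesis using \<kappa>(2)[of l n] that by (simp add: mult_ac)
  qed
  then show ?thesis using \<kappa>(1) c(1) by (intro exI[of _ "\<kappa> * c"]) auto
qed

section \<open>The case \<alpha> < 1\<close>

text \<open>The limit ratio \<open>2 powr (- \<alpha>)\<close> exceeds 1/2, so
  \<open>sum_le_mult_nth\<close> bounds \<open>truncated_mean p l\<close> by a multiple of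
  \<open>l * tail p l\<close>, and \<open>l / truncated_mean p l\<close> is at least a multiple of
  \<open>1 / tail p l\<close>.\<close>

lemma tv_dist_law_ge_min:
  assumes "\<alpha> < 1"
  shows "\<exists>\<kappa>>0. \<forall>n l. l \<ge> 1 \<longrightarrow>
    tv_dist (law (n + l)) (law n) \<ge> \<kappa> * min 1 (tail p n / tail p l)"
proof -
  have "2 powr (- 1) < 2 powr (- \<alpha>)" using assms by (intro powr_less_mono) auto
  then have "1 / 2 < 2 powr (- \<alpha>)" by (simp add: powr_minus)
  then obtain r where r: "1 / 2 < r" "r < 2 powr (- \<alpha>)" using dense by blast
  have "eventually (\<lambda>n. r * tail p n \<le> tail p (2 * n)) sequentially"
    using order_tendstoD(1)[OF tail_double_lim r(2)]
    by eventually_elim (use tail_pos in \<open>simp add: field_simps\<close>)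
  then obtain C where C: "C > 0" "\<And>n. n \<ge> 1 \<Longrightarrow> truncated_mean p n \<le> C * real n * tail p n"
    unfolding truncated_mean_def
    using sum_le_mult_nth[OF antimono_tail tail_pos r(1)] by metis
  obtain c where c: "c > 0" "\<And>n. c * tail p n \<le> tail p (2 * n)" using tail_double_ge by metis
  have "tv_dist (law (n + l)) (law n) \<ge> (c / C) * min 1 (tail p n / tail p l)" if "l \<ge> 1" for n l
  proof -
    \<comment> \<open>Since the tails decrease, the minimum equals
      \<open>tail p M / tail p l\<close>; moreover \<open>n + l \<le> 2 * M\<close>.\<close>
    define M where "M = max n l"
    have "min 1 (tail p n / tail p l) * tail p l \<le> tail p M"
      using tail_pos[of l] by (auto simp: M_def min_def max_def field_simps)
    then have "min 1 (tail p n / tail p l) \<le> tail p M / tail p l"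
      using tail_pos[of l] by (simp add: field_simps)
    then have "(c / C) * min 1 (tail p n / tail p l) \<le> (c / C) * (tail p M / tail p l)"
      using c(1) C(1) by (intro mult_left_mono) auto
    also have "\<dots> = c * tail p M * (1 / (C * tail p l))" by simp
    also have "\<dots> \<le> tail p (n + l) * (real l / truncated_mean p l)"
    proof (intro mult_mono)
      have "n + l \<le> 2 * M" by (simp add: M_def)
      then show "c * tail p M \<le> tail p (n + l)"
        using c(2)[of M] antimonoD[OF antimono_tail, of "n + l" "2 * M"] by linarith
      show "1 / (C * tail p l) \<le> real l / truncated_mean p l"
        using C(2)[OF that] C(1) tail_pos[of l] truncated_mean_pos[OF that] by (simp add: field_simps)
    qed (use C tail_pos in \<open>auto intro: less_imp_le\<close>)
    also have "\<dots> \<le> tv_dist (law (n + l)) (law n)"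
      by (rule tv_dist_law_ge_truncated_mean[OF that])
    finally show ?thesis .
  qed
  then show ?thesis using c(1) C(1) by (intro exI[of _ "c / C"]) auto
qed

section \<open>The case \<alpha> = 1\<close>

text \<open>
  Since \<open>tail p (n div 2)\<close> is eventually larger than \<open>tail p n\<close> by a factor \<open>3/2\<close>,
  \<open>n * tail p n\<close> is at most \<open>6/7\<close> of \<open>truncated_mean p n\<close>: doubling \<open>n\<close>
  multiplies the truncated mean by a factor bounded away from \<open>2\<close>.
\<close>

lemma truncated_mean_double:
  assumes "\<alpha> = 1"
  shows "eventually (\<lambda>n. truncated_mean p (2 * n) \<le> 13 / 7 * truncated_mean p n) sequentially"
proof -
  have "(\<lambda>n. tail p (2 * n) / tail p n) \<longlonglongrightarrow> 1 / 2"
    using tail_double_lim by (simp add: assms powr_minus)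
  from order_tendstoD(2)[OF this, of "2 / 3"]
  obtain N where N: "\<And>n. n \<ge> N \<Longrightarrow> tail p (2 * n) / tail p n < 2 / 3"
    by (auto simp: eventually_sequentially)
  have "truncated_mean p (2 * n) \<le> 13 / 7 * truncated_mean p n" if n: "n \<ge> 2 * N + 2" for n
  proof -
    \<comment> \<open>The bound \<open>n \<ge> 2 * N + 2\<close> gives \<open>h \<ge> N\<close> and
      \<open>h \<ge> 1\<close>, hence \<open>n \<le> 2 * h + 1 \<le> 3 * h\<close>. With
      \<open>h \<ge> n / 3\<close>, the gain of \<open>h / 2\<close> over \<open>n\<close> yields
      the factor 7/6.\<close>
    define h where "h = n div 2"
    have h: "h \<ge> N" "2 * h \<le> n" "n \<le> 3 * h" using n by (auto simp: h_def)
    have "tail p (2 * h) < 2 / 3 * tail p h"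
      using N[OF h(1)] tail_pos[of h] by (simp add: field_simps)
    then have zh: "3 / 2 * tail p n \<le> tail p h"
      using antimonoD[OF antimono_tail h(2)] by linarith
    have "{..<n} = {..<h} \<union> {h..<n}" using h(2) by auto
    then have "truncated_mean p n = (\<Sum>k<h. tail p k) + (\<Sum>k=h..<n. tail p k)"
      by (simp add: truncated_mean_def sum.union_disjoint ivl_disj_int)
    moreover have "(\<Sum>k<h. tail p k) \<ge> (\<Sum>k<h. 3 / 2 * tail p n)"
      using zh by (intro sum_mono order_trans[OF zh] antimonoD[OF antimono_tail]) auto
    moreover have "(\<Sum>k=h..<n. tail p k) \<ge> (\<Sum>k=h..<n. tail p n)"
      by (intro sum_mono antimonoD[OF antimono_tail]) auto
    ultimately have "truncated_mean p n \<ge> real h * (3 / 2 * tail p n) + (real n - real h) * tail p n"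
      using h by (simp add: of_nat_diff)
    moreover have "real h * (3 / 2 * tail p n) + (real n - real h) * tail p n
        = (real n + real h / 2) * tail p n" by (simp add: algebra_simps)
    moreover have "(7 / 6 * real n) * tail p n \<le> (real n + real h / 2) * tail p n"
      using h(3) less_imp_le[OF tail_pos] by (intro mult_right_mono) auto
    ultimately have "real n * tail p n \<le> 6 / 7 * truncated_mean p n" by linarith
    moreover have "(\<Sum>k=n..<2 * n. tail p k) \<le> (\<Sum>k=n..<2 * n. tail p n)"
      by (intro sum_mono antimonoD[OF antimono_tail]) auto
    ultimately show ?thesis
      by (simp add: truncated_mean_def sum_lessThan_double)
  qed
  then show ?thesis unfolding eventually_sequentially by blast
qed

text \<open>By \<open>truncated_mean_double\<close> the inverse truncated mean keeps at least 7/13 >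
  1/2 of its value under doubling, as \<open>sum_le_mult_nth\<close> requires.\<close>

lemma sum_inverse_truncated_mean_le:
  assumes "\<alpha> = 1"
  obtains C where "C > 0"
    "\<And>l. l \<ge> 1 \<Longrightarrow> (\<Sum>k\<in>{1..<l}. inverse (truncated_mean p k)) \<le> C * (real l / truncated_mean p l)"
proof -
  \<comment> \<open>\<open>truncated_mean p 0\<close> is 0 and so is its \<open>inverse\<close>;
    \<open>max 1 k\<close> keeps \<open>f\<close> positive and decreasing at 0.\<close>
  define f where "f k = inverse (truncated_mean p (max 1 k))" for k
  have "antimono f"
    unfolding f_def
    by (intro antimonoI le_imp_inverse_le monoD[OF mono_truncated_mean] truncated_mean_pos) auto
  moreover have "\<And>n. f n > 0" by (simp add: f_def truncated_mean_pos)
  moreover have "eventually (\<lambda>n. 7 / 13 * f n \<le> f (2 * n)) sequentially"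
    using truncated_mean_double[OF assms] eventually_ge_at_top[of 1]
  proof eventually_elim
    case (elim n)
    then show ?case
      using truncated_mean_pos[of n] truncated_mean_pos[of "2 * n"] by (simp add: f_def field_simps max_def)
  qed
  ultimately obtain C where C: "C > 0" "\<And>n. n \<ge> 1 \<Longrightarrow> (\<Sum>k<n. f k) \<le> C * real n * f n"
    using sum_le_mult_nth[of f "7 / 13"] by auto
  have "(\<Sum>k\<in>{1..<l}. inverse (truncated_mean p k)) \<le> C * (real l / truncated_mean p l)" if "l \<ge> 1" for l
  proof -
    have "(\<Sum>k\<in>{1..<l}. inverse (truncated_mean p k)) = (\<Sum>k\<in>{1..<l}. f k)"
      by (intro sum.cong) (auto simp: f_def max_def)
    also have "\<dots> \<le> (\<Sum>k<l. f k)"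
      using \<open>\<And>n. f n > 0\<close> by (intro sum_mono2) (auto intro: less_imp_le)
    also have "\<dots> \<le> C * real l * f l" by (rule C(2)[OF that])
    finally show ?thesis using that by (simp add: f_def max_def divide_inverse mult_ac)
  qed
  then show thesis using that C(1) by blast
qed

text \<open>The sum of inverses is at most a multiple of \<open>l / truncated_mean p l\<close>,
  which \<open>tv_dist_law_ge_truncated_mean\<close> handles; \<open>n + l \<le> 2 * n\<close> lets
  one doubling replace \<open>tail p (n + l)\<close> by \<open>tail p n\<close>.\<close>

lemma tv_dist_law_ge_sum_inverse:
  assumes "\<alpha> = 1"
  shows "\<exists>\<kappa>>0. \<forall>n l. 1 \<le> l \<and> l \<le> n \<longrightarrow> tv_dist (law (n + l)) (law n)
    \<ge> \<kappa> * tail p n * (\<Sum>k\<in>{1..<l}. inverse (truncated_mean p k))"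
proof -
  obtain C where C: "C > 0"
    "\<And>l. l \<ge> 1 \<Longrightarrow> (\<Sum>k\<in>{1..<l}. inverse (truncated_mean p k)) \<le> C * (real l / truncated_mean p l)"
    using sum_inverse_truncated_mean_le[OF assms] by metis
  obtain c where c: "c > 0" "\<And>n. c * tail p n \<le> tail p (2 * n)" using tail_double_ge by metis
  have "tv_dist (law (n + l)) (law n)
        \<ge> (c / C) * tail p n * (\<Sum>k\<in>{1..<l}. inverse (truncated_mean p k))"
    if l: "1 \<le> l" "l \<le> n" for n l
  proof -
    have "(c / C) * tail p n * (\<Sum>k\<in>{1..<l}. inverse (truncated_mean p k))
        \<le> (c / C) * tail p n * (C * (real l / truncated_mean p l))"
      using c(1) C(1) tail_pos[of n] by (intro mult_left_mono C(2) l) auto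
    also have "\<dots> = (c * tail p n) * (real l / truncated_mean p l)" using C(1) by simp
    also have "\<dots> \<le> tail p (n + l) * (real l / truncated_mean p l)"
    proof (rule mult_right_mono)
      show "c * tail p n \<le> tail p (n + l)"
        using c(2)[of n] l antimonoD[OF antimono_tail, of "n + l" "2 * n"] by simp
      show "0 \<le> real l / truncated_mean p l" using truncated_mean_pos[OF l(1)] by simp
    qed
    also have "\<dots> \<le> tv_dist (law (n + l)) (law n)"
      by (rule tv_dist_law_ge_truncated_mean[OF l(1)])
    finally show ?thesis .
  qed
  then show ?thesis using c(1) C(1) by (intro exI[of _ "c / C"]) auto
qed

end

theorem corollary2p4:
  fixes p q :: "nat \<Rightarrow> real" and \<alpha> :: real
  assumes p_nonneg: "\<And>n. n \<ge> 1 \<Longrightarrow> p n \<ge> 0"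
    and p_sum: "(p has_sum 1) {1..}"
    and p_aperiodic: "Gcd {k. k \<ge> 1 \<and> p k > 0} = 1"
    and q: "return_probs p q"
    and reg: "regularly_varying (tail p) (- \<alpha>)"
  shows
    "(\<alpha> > 1 \<longrightarrow>
        (\<exists>\<kappa>>0. \<forall>n l. l \<ge> 1 \<longrightarrow>
           tv_dist ((transition_op q ^^ (n + l)) (return_pmf 0)) ((transition_op q ^^ n) (return_pmf 0))
             \<ge> \<kappa> * (\<Sum>m = n + 1..n + l. tail p m)) \<and>
        (\<exists>\<kappa>'>0. \<forall>n l. 1 \<le> l \<and> l \<le> n \<longrightarrow>
           tv_dist ((transition_op q ^^ (n + l)) (return_pmf 0)) ((transition_op q ^^ n) (return_pmf 0))
             \<ge> \<kappa>' * real l * tail p n)) \<and>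
     (0 < \<alpha> \<and> \<alpha> < 1 \<longrightarrow>
        (\<exists>\<kappa>>0. \<forall>n l. l \<ge> 1 \<longrightarrow>
           tv_dist ((transition_op q ^^ (n + l)) (return_pmf 0)) ((transition_op q ^^ n) (return_pmf 0))
             \<ge> \<kappa> * min 1 (tail p n / tail p l))) \<and>
     (\<alpha> = 1 \<longrightarrow>
        (\<exists>\<kappa>>0. \<forall>n l. 1 \<le> l \<and> l \<le> n \<longrightarrow>
           tv_dist ((transition_op q ^^ (n + l)) (return_pmf 0)) ((transition_op q ^^ n) (return_pmf 0))
             \<ge> \<kappa> * tail p n * (\<Sum>k\<in>{1..<l}. inverse (truncated_mean p k))))"
proof -
  interpret regular_return_chain p q \<alpha>
  proof unfold_locales
    show "tail p n > 0" for n using reg by (simp add: regularly_varying_def)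
  qed (fact p_nonneg p_sum q reg)+
  show ?thesis
    by (intro conjI impI tv_dist_law_ge_tails tv_dist_law_ge_linear tv_dist_law_ge_min
        tv_dist_law_ge_sum_inverse) auto
qed

end
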